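(* For positive integers $m,t$, let $h(m,t)$ be the maximum, over all $n$, all $A\in\mathbb{Z}^{m\times n}$ with $\|A\|_\infty\leq t$ and all $b\in\mathcal{L}(A)$, of $\min\{\|x\|_0\mid Ax=b,\ x\in\mathbb{Z}^n\}$. Then $$h(m,t)\leq O\left(\frac{m\log(\sqrt{m}\,t)}{\log\log(\sqrt{m}\,t)}\right),$$ i.e. there exist absolute constants $K>0$ and $N>0$ such that for all positive integers $m,t$ with $\sqrt{m}\,t\geq N$, $$h(m,t)\leq K\,\frac{m\log(\sqrt{m}\,t)}{\log\log(\sqrt{m}\,t)}.$$
   Context: For a matrix $A\in\mathbb{Z}^{m\times n}$: $\mathcal{L}(A):=\{Ax\mid x\in\mathbb{Z}^n\}$ is the lattice generated by the columns of $A$; $\|A\|_\infty$ is the largest absolute value of an entry of $A$. For $x\in\mathbb{Z}^n$, $\|x\|_0:=|\{j: x_j\neq 0\}|$ is the support size. $\log$ denotes the natural logarithm. *)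

theory Defs
  imports
    Complex_Main
    "HOL-Library.Extended_Nat"
    "HOL-Library.Extended_Real"
    "Jordan_Normal_Form.Matrix"
begin

definition int_lattice :: "int mat \<Rightarrow> int vec set" where
  "int_lattice A = {A *\<^sub>v x | x. x \<in> carrier_vec (dim_col A)}"

text \<open>The inserted \<open>0\<close> only matters for matrices without entries, whose norm is \<open>0\<close>.\<close>

definition max_norm :: "int mat \<Rightarrow> int" where
  "max_norm A = Max (insert 0 (abs ` elements_mat A))"

definition supp_size :: "int vec \<Rightarrow> nat" where
  "supp_size x = card {j. j < dim_vec x \<and> x $ j \<noteq> 0}"

text \<open>The minimum is over a set that is always finite, and that is nonempty if and only if
  \<open>b\<close> lies in the lattice of \<open>A\<close>; see the two lemmas below.\<close>

definition min_supp :: "int mat \<Rightarrow> int vec \<Rightarrow> nat" where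
  "min_supp A b = Min {supp_size x | x. x \<in> carrier_vec (dim_col A) \<and> A *\<^sub>v x = b}"

lemma finite_supp_sizes:
  "finite {supp_size x | x. x \<in> carrier_vec (dim_col A) \<and> A *\<^sub>v x = b}"
proof (rule finite_subset)
  show "{supp_size x | x. x \<in> carrier_vec (dim_col A) \<and> A *\<^sub>v x = b} \<subseteq> {..dim_col A}"
  proof
    fix k assume "k \<in> {supp_size x | x. x \<in> carrier_vec (dim_col A) \<and> A *\<^sub>v x = b}"
    then obtain x where k: "k = supp_size x" and "x \<in> carrier_vec (dim_col A)" by blast
    then have "{j. j < dim_vec x \<and> x $ j \<noteq> 0} \<subseteq> {..<dim_col A}" by auto
    from card_mono[OF _ this] show "k \<in> {..dim_col A}"
      by (simp add: k supp_size_def)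
  qed
qed simp

lemma supp_sizes_nonempty_iff:
  "{supp_size x | x. x \<in> carrier_vec (dim_col A) \<and> A *\<^sub>v x = b} \<noteq> {} \<longleftrightarrow> b \<in> int_lattice A"
  by (auto simp: int_lattice_def)

definition min_supp_values :: "nat \<Rightarrow> nat \<Rightarrow> nat set" where
  "min_supp_values m t =
     {min_supp A b | n A b. A \<in> carrier_mat m n \<and> max_norm A \<le> int t \<and> b \<in> int_lattice A}"

text \<open>The maximum is taken as a supremum in \<^typ>\<open>enat\<close>, so that an unbounded set of values gives
  \<open>\<infinity>\<close> instead of an unspecified natural number. Whenever it is finite, it is the maximum.\<close>

definition h :: "nat \<Rightarrow> nat \<Rightarrow> enat" where
  "h m t = (SUP k \<in> min_supp_values m t. enat k)"

lemma min_supp_values_nonempty: "min_supp_values m t \<noteq> {}"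
proof -
  have "max_norm (0\<^sub>m m 0) \<le> int t"
    by (simp add: max_norm_def elements_mat_def)
  moreover have "0\<^sub>m m 0 *\<^sub>v 0\<^sub>v 0 \<in> int_lattice (0\<^sub>m m 0)"
    unfolding int_lattice_def by auto
  ultimately have "min_supp (0\<^sub>m m 0) (0\<^sub>m m 0 *\<^sub>v 0\<^sub>v 0) \<in> min_supp_values m t"
    unfolding min_supp_values_def using zero_carrier_mat by blast
  then show ?thesis by blast
qed

lemma h_eq_Max:
  assumes "h m t \<noteq> \<infinity>"
  shows "finite (min_supp_values m t)" "h m t = enat (Max (min_supp_values m t))"
proof -
  obtain c where c: "h m t = enat c" using assms by auto
  have "k \<le> c" if "k \<in> min_supp_values m t" for k
    using SUP_upper[of k "min_supp_values m t" enat, OF that] c by (simp add: h_def)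
  then show fin: "finite (min_supp_values m t)"
    by (meson finite_nat_set_iff_bounded_le)
  show "h m t = enat (Max (min_supp_values m t))"
    unfolding h_def
    using fin min_supp_values_nonempty[of m t]
    by (intro antisym SUP_least SUP_upper) (auto intro: Max_ge Max_in)
qed

end

theory Submission
  imports Defs
begin

text \<open>Take a solution of minimal support \<open>S\<close>. The values at \<open>j \<in> S\<close> of the integer relations among
  the columns in \<open>S\<close> form an ideal \<open>d\<^sub>j \<int>\<close>, and \<open>d\<^sub>j \<noteq> 1\<close>: a relation with value \<open>1\<close> at \<open>j\<close> would
  eliminate \<open>j\<close> from the support. Each value \<open>d\<close> is attained by at most \<open>m\<close> indices, since any
  \<open>m + 1\<close> columns satisfy a relation whose entries are not all divisible by \<open>d\<close>. The indices
  with \<open>d\<^sub>j = 0\<close> or \<open>d\<^sub>j > Q\<close> admit no nonzero relation with entries of size at most \<open>Q\<close>, so by the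
  pigeonhole principle there are only \<open>O(m ln (m t) / ln Q)\<close> of them. Finally take \<open>Q\<close> to be
  about \<open>sqrt (ln (sqrt m t))\<close>.\<close>

section \<open>Integer relations among columns\<close>

text \<open>Columns and coefficients are functions of the index, so passing to a subset of the
  columns needs no renumbering.\<close>

definition relation_on :: "nat \<Rightarrow> (nat \<Rightarrow> nat \<Rightarrow> int) \<Rightarrow> nat set \<Rightarrow> (nat \<Rightarrow> int) \<Rightarrow> bool" where
  "relation_on m a S c \<longleftrightarrow> (\<forall>i<m. (\<Sum>j\<in>S. a i j * c j) = 0)"

lemma relation_on_superset:
  assumes "relation_on m a K c" "K \<subseteq> S" "finite S"
  shows "relation_on m a S (\<lambda>j. if j \<in> K then c j else 0)"
  using assms
  by (auto simp: relation_on_def if_distrib sum.If_cases Int_absorb1 cong: if_cong)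

lemma relation_on_scale_iff:
  "relation_on m a S (\<lambda>j. k * c j) \<longleftrightarrow> k = 0 \<or> relation_on m a S c"
proof -
  have "(\<Sum>j\<in>S. a i j * (k * c j)) = k * (\<Sum>j\<in>S. a i j * c j)" for i
    by (simp add: sum_distrib_left mult_ac)
  then show ?thesis by (auto simp: relation_on_def)
qed

lemma relation_on_diff:
  "relation_on m a S c \<Longrightarrow> relation_on m a S c' \<Longrightarrow> relation_on m a S (\<lambda>j. c j - c' j)"
  by (simp add: relation_on_def right_diff_distrib sum_subtractf)

section \<open>Existence of relations by the pigeonhole principle\<close>

text \<open>The argument of Siegel's lemma: the left side of \<open>many\<close> counts a box
  containing the images of the \<open>B ^ card K\<close> vectors with entries from 0 to
  \<open>B - 1\<close>. Two of these have the same image, and their difference is the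
  relation.\<close>

lemma small_relation_exists:
  fixes a :: "nat \<Rightarrow> nat \<Rightarrow> int"
  assumes fin: "finite K"
    and bound: "\<And>i j. i < m \<Longrightarrow> j \<in> K \<Longrightarrow> \<bar>a i j\<bar> \<le> int t"
    and many: "(2 * t * card K * B + 1) ^ m < B ^ card K"
  obtains c where "relation_on m a K c" "\<And>j. j \<in> K \<Longrightarrow> \<bar>c j\<bar> < int B" "\<exists>j\<in>K. c j \<noteq> 0"
proof -
  define M where "M = int (t * card K * B)"
  define X where "X = K \<rightarrow>\<^sub>E {0..<int B}"
  define Y where "Y = {..<m} \<rightarrow>\<^sub>E {- M..M}"
  define f where "f c = (\<lambda>i\<in>{..<m}. \<Sum>j\<in>K. a i j * c j)" for c :: "nat \<Rightarrow> int"
  have "f c \<in> Y" if c: "c \<in> X" for c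
  proof -
    have "\<bar>\<Sum>j\<in>K. a i j * c j\<bar> \<le> M" if "i < m" for i
    proof -
      have "\<bar>\<Sum>j\<in>K. a i j * c j\<bar> \<le> (\<Sum>j\<in>K. \<bar>a i j * c j\<bar>)" by (rule sum_abs)
      also have "\<dots> \<le> (\<Sum>j\<in>K. int t * int B)"
      proof (rule sum_mono)
        fix j assume j: "j \<in> K"
        then have "c j \<in> {0..<int B}" using c by (auto simp: X_def)
        then show "\<bar>a i j * c j\<bar> \<le> int t * int B"
          using bound[OF \<open>i < m\<close> j] by (auto simp: abs_mult intro!: mult_mono)
      qed
      also have "\<dots> = M" by (simp add: M_def)
      finally show ?thesis .
    qed
    then show ?thesis by (auto simp: Y_def f_def abs_le_iff minus_le_iff)
  qed
  then have "f ` X \<subseteq> Y" by blast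
  moreover have "finite Y" by (simp add: Y_def finite_PiE)
  moreover have "card Y < card X"
  proof -
    have "nat (1 + M + M) = 2 * t * card K * B + 1"
      by (simp add: M_def nat_eq_iff)
    then have "card Y = (2 * t * card K * B + 1) ^ m"
      by (simp add: Y_def card_PiE add.commute add.left_commute)
    moreover have "card X = B ^ card K"
      using fin by (simp add: X_def card_PiE)
    ultimately show ?thesis using many by simp
  qed
  ultimately have "\<not> inj_on f X" by (meson card_inj_on_le not_le)
  then obtain c c' where cc: "c \<in> X" "c' \<in> X" "f c = f c'" "c \<noteq> c'"
    by (auto simp: inj_on_def)
  have rng: "c j \<in> {0..<int B}" "c' j \<in> {0..<int B}" if "j \<in> K" for j
    using cc that by (auto simp: X_def)
  show thesis
  proof
    have "(\<Sum>j\<in>K. a i j * c j) = (\<Sum>j\<in>K. a i j * c' j)" if "i < m" for i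
      using fun_cong[OF cc(3), of i] that by (simp add: f_def)
    then show "relation_on m a K (\<lambda>j. c j - c' j)"
      by (simp add: relation_on_def right_diff_distrib sum_subtractf)
    show "\<bar>c j - c' j\<bar> < int B" if "j \<in> K" for j
      using rng[OF that] by auto
    show "\<exists>j\<in>K. c j - c' j \<noteq> 0"
      using cc by (metis PiE_ext X_def eq_iff_diff_eq_0)
  qed
qed

lemma relation_exists:
  fixes a :: "nat \<Rightarrow> nat \<Rightarrow> int"
  assumes fin: "finite K" and big: "m < card K"
    and bound: "\<And>i j. i < m \<Longrightarrow> j \<in> K \<Longrightarrow> \<bar>a i j\<bar> \<le> int t"
  obtains c where "relation_on m a K c" "\<exists>j\<in>K. c j \<noteq> 0"
proof -
  define W where "W = 2 * t * card K + 1"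
  \<comment> \<open>The base in the pigeonhole condition is at most \<open>W * B\<close>, so its
    power is at most \<open>W ^ m * B ^ m\<close>. Since \<open>B > W ^ m\<close>, this stays below
    \<open>B ^ (m + 1)\<close>.\<close>
  define B where "B = W ^ m + 1"
  have "2 * t * card K * B + 1 \<le> W * B"
    by (simp add: W_def B_def)
  then have "(2 * t * card K * B + 1) ^ m \<le> (W * B) ^ m"
    by (rule power_mono) simp
  also have "\<dots> = W ^ m * B ^ m" by (rule power_mult_distrib)
  also have "\<dots> < B * B ^ m" by (simp add: B_def)
  also have "\<dots> = B ^ Suc m" by simp
  also have "\<dots> \<le> B ^ card K" using big by (intro power_increasing) (auto simp: B_def)
  finally have "(2 * t * card K * B + 1) ^ m < B ^ card K" .
  from small_relation_exists[of K m a t, OF fin bound this] that show thesis by blast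
qed

text \<open>Relations are homogeneous, so a nonzero one may be divided by the gcd of its
  entries.\<close>

lemma primitive_relation_exists:
  fixes a :: "nat \<Rightarrow> nat \<Rightarrow> int"
  assumes fin: "finite K" and big: "m < card K"
    and bound: "\<And>i j. i < m \<Longrightarrow> j \<in> K \<Longrightarrow> \<bar>a i j\<bar> \<le> int t"
  obtains c where "relation_on m a K c" "Gcd (c ` K) = 1"
proof -
  obtain c where c: "relation_on m a K c" "\<exists>j\<in>K. c j \<noteq> 0"
    using relation_exists[of K m a t, OF fin big bound] by blast
  define g where "g = Gcd (c ` K)"
  have g0: "g \<noteq> 0" using c(2) by (auto simp: g_def)
  define c' where "c' j = c j div g" for j
  have cj: "c j = g * c' j" if "j \<in> K" for j
    using that by (simp add: c'_def g_def)
  have "relation_on m a K (\<lambda>j. g * c' j)"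
    using c(1) by (simp add: relation_on_def cj)
  then have rel: "relation_on m a K c'" using g0 by (simp add: relation_on_scale_iff)
  have "c ` K = (*) g ` c' ` K" by (force simp: cj image_image)
  then have "g = normalize (g * Gcd (c' ` K))" by (subst g_def) (simp only: Gcd_mult)
  moreover have "g \<ge> 0" by (simp add: g_def)
  ultimately have "Gcd (c' ` K) = 1" using g0 by (simp add: abs_mult)
  with rel that show thesis by blast
qed

section \<open>Divisors of the values of relations\<close>

text \<open>Division with remainder by the least positive element. If there is none, the ideal is
  zero and \<open>d = 0\<close> generates it.\<close>

lemma int_ideal_generator:
  fixes I :: "int set"
  assumes zero: "0 \<in> I" and diff: "\<And>x y. x \<in> I \<Longrightarrow> y \<in> I \<Longrightarrow> x - y \<in> I"
    and scale: "\<And>k x. x \<in> I \<Longrightarrow> k * x \<in> I"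
  obtains d :: nat where "int d \<in> I" "\<And>x. x \<in> I \<Longrightarrow> int d dvd x"
proof (cases "\<exists>d>0. int d \<in> I")
  case True
  define d where "d = (LEAST d. d > 0 \<and> int d \<in> I)"
  have d: "d > 0" "int d \<in> I"
    using LeastI_ex[OF True] by (auto simp: d_def)
  have "int d dvd x" if x: "x \<in> I" for x
  proof (rule ccontr)
    assume "\<not> int d dvd x"
    then have "x mod int d \<noteq> 0" by (simp only: dvd_eq_mod_eq_0 not_False_eq_True)
    moreover have "x mod int d \<ge> 0" using d(1) by simp
    ultimately have pos: "x mod int d > 0" by linarith
    have "x mod int d = x - (x div int d) * int d"
      by (simp add: minus_div_mult_eq_mod)
    then have "x mod int d \<in> I" using diff[OF x scale[OF d(2)]] by simp
    with pos have "d \<le> nat (x mod int d)"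
      by (subst d_def, intro Least_le) simp
    moreover have "x mod int d < int d" using d(1) by simp
    ultimately show False using pos by linarith
  qed
  with d(2) that show thesis by blast
next
  case False
  have "x = 0" if x: "x \<in> I" for x
  proof (rule ccontr)
    assume "x \<noteq> 0"
    have "int (nat \<bar>x\<bar>) \<in> I"
      using x scale[OF x, of "-1"] by (simp add: abs_if)
    moreover have "nat \<bar>x\<bar> > 0" using \<open>x \<noteq> 0\<close> by simp
    ultimately show False using False by blast
  qed
  with that[of 0] zero show thesis by simp
qed

text \<open>More than \<open>m\<close> columns in one fibre would carry a relation with entries of
  gcd 1. Extended by zero to \<open>S\<close>, it has all entries on the fibre divisible by
  \<open>e\<close>, which forces \<open>e = 1\<close>.\<close>

lemma card_divisor_fibre_le:
  fixes a :: "nat \<Rightarrow> nat \<Rightarrow> int"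
  assumes fin: "finite S"
    and bound: "\<And>i j. i < m \<Longrightarrow> j \<in> S \<Longrightarrow> \<bar>a i j\<bar> \<le> int t"
    and dvd: "\<And>c j. relation_on m a S c \<Longrightarrow> j \<in> S \<Longrightarrow> int (d j) dvd c j"
    and e: "e \<noteq> 1"
  shows "card {j\<in>S. d j = e} \<le> m"
proof (rule ccontr)
  define K where "K = {j\<in>S. d j = e}"
  have K: "K \<subseteq> S" "finite K" using fin by (auto simp: K_def)
  assume "\<not> ?thesis"
  then have "m < card K" by (simp add: K_def)
  then obtain c where c: "relation_on m a K c" "Gcd (c ` K) = 1"
    using primitive_relation_exists[of K m a t] K bound by (metis subsetD)
  have "int e dvd c j" if "j \<in> K" for j
    using dvd[OF relation_on_superset[OF c(1) K(1) fin], of j] that by (auto simp: K_def)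
  then have "int e dvd Gcd (c ` K)" by (auto intro: Gcd_greatest)
  with c(2) e show False by simp
qed

text \<open>A nonzero relation on \<open>K\<close> with entries of size at most \<open>Q\<close> is
  impossible: a nonzero entry would be a multiple of some \<open>d j > Q\<close>. Hence the
  pigeonhole condition with \<open>B = Q + 1\<close> must fail, which is the conclusion.\<close>

lemma card_large_divisors:
  fixes a :: "nat \<Rightarrow> nat \<Rightarrow> int" and Q :: nat
  assumes fin: "finite S"
    and bound: "\<And>i j. i < m \<Longrightarrow> j \<in> S \<Longrightarrow> \<bar>a i j\<bar> \<le> int t"
    and dvd: "\<And>c j. relation_on m a S c \<Longrightarrow> j \<in> S \<Longrightarrow> int (d j) dvd c j"
  defines "K \<equiv> {j\<in>S. d j = 0 \<or> d j > Q}"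
  shows "(Q + 1) ^ card K \<le> (2 * t * card K * (Q + 1) + 1) ^ m"
proof (rule ccontr)
  have K: "K \<subseteq> S" "finite K" using fin by (auto simp: K_def)
  assume "\<not> ?thesis"
  then have less: "(2 * t * card K * (Q + 1) + 1) ^ m < (Q + 1) ^ card K" by simp
  obtain c where c: "relation_on m a K c" "\<And>j. j \<in> K \<Longrightarrow> \<bar>c j\<bar> < int (Q + 1)"
      "\<exists>j\<in>K. c j \<noteq> 0"
    by (rule small_relation_exists[OF K(2) _ less, of a]) (use bound K in auto)
  then obtain j where j: "j \<in> K" "c j \<noteq> 0" by blast
  then have "int (d j) dvd c j"
    using dvd[OF relation_on_superset[OF c(1) K(1) fin], of j] K(1) by auto
  then have "int (d j) \<le> \<bar>c j\<bar>" "d j \<noteq> 0"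
    using j(2) dvd_imp_le_int[of "c j" "int (d j)"] by auto
  with c(2)[OF j(1)] j(1) show False by (auto simp: K_def)
qed

text \<open>The divisors from 2 to \<open>Q\<close> account for at most \<open>m\<close> indices
  each; \<open>k\<close> counts the remaining indices, whose divisor is 0 or exceeds
  \<open>Q\<close>.\<close>

lemma card_split_bound:
  fixes a :: "nat \<Rightarrow> nat \<Rightarrow> int"
  assumes fin: "finite S"
    and bound: "\<And>i j. i < m \<Longrightarrow> j \<in> S \<Longrightarrow> \<bar>a i j\<bar> \<le> int t"
    and dvd: "\<And>c j. relation_on m a S c \<Longrightarrow> j \<in> S \<Longrightarrow> int (d j) dvd c j"
    and ne1: "\<And>j. j \<in> S \<Longrightarrow> d j \<noteq> 1"
  obtains k where "card S \<le> m * Q + k" "(Q + 1) ^ k \<le> (2 * t * k * (Q + 1) + 1) ^ m"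
proof
  define K where "K = {j\<in>S. d j = 0 \<or> d j > Q}"
  have "S \<subseteq> (\<Union>e\<in>{2..Q}. {j\<in>S. d j = e}) \<union> K"
  proof
    fix j assume "j \<in> S"
    with ne1[of j] show "j \<in> (\<Union>e\<in>{2..Q}. {j\<in>S. d j = e}) \<union> K"
      by (cases "d j = 0 \<or> d j > Q") (auto simp: K_def)
  qed
  then have "card S \<le> card ((\<Union>e\<in>{2..Q}. {j\<in>S. d j = e}) \<union> K)"
    using fin by (intro card_mono) (auto simp: K_def)
  also have "\<dots> \<le> card (\<Union>e\<in>{2..Q}. {j\<in>S. d j = e}) + card K" by (rule card_Un_le)
  also have "card (\<Union>e\<in>{2..Q}. {j\<in>S. d j = e}) \<le> (\<Sum>e\<in>{2..Q}. card {j\<in>S. d j = e})"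
    by (rule card_UN_le) simp
  also have "\<dots> \<le> (\<Sum>e\<in>{2..Q}. m)"
  proof (rule sum_mono)
    fix e assume "e \<in> {2..Q}"
    then show "card {j\<in>S. d j = e} \<le> m"
      by (intro card_divisor_fibre_le[of S m a t d e]) (use fin bound dvd in auto)
  qed
  also have "\<dots> \<le> m * Q" by simp
  finally show "card S \<le> m * Q + card K" by simp
  show "(Q + 1) ^ card K \<le> (2 * t * card K * (Q + 1) + 1) ^ m"
    unfolding K_def by (rule card_large_divisors[of S m a t d]) (use fin bound dvd in auto)
qed

section \<open>Solutions of minimal support\<close>

text \<open>Subtracting \<open>x $ j\<close> times a relation with value 1 at \<open>j\<close> keeps
  the image under \<open>A\<close>, removes \<open>j\<close> from the support and adds no new
  index.\<close>

lemma minimal_support_relations: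
  fixes A :: "int mat"
  assumes A: "A \<in> carrier_mat m n" and x: "x \<in> carrier_vec n" "A *\<^sub>v x = b"
    and minimal: "\<And>y. y \<in> carrier_vec n \<Longrightarrow> A *\<^sub>v y = b \<Longrightarrow> supp_size x \<le> supp_size y"
  defines "S \<equiv> {j. j < n \<and> x $ j \<noteq> 0}"
  assumes c: "relation_on m (\<lambda>i j. A $$ (i, j)) S c" and j: "j \<in> S"
  shows "c j \<noteq> 1"
proof
  assume c1: "c j = 1"
  have fin: "finite S" by (simp add: S_def)
  define y where "y = vec n (\<lambda>l. if l \<in> S then x $ l - x $ j * c l else 0)"
  have y: "y \<in> carrier_vec n" by (simp add: y_def)
  have restrict: "(A *\<^sub>v z) $ i = (\<Sum>l\<in>S. A $$ (i, l) * z $ l)"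
    if "i < m" "z \<in> carrier_vec n" "\<And>l. l < n \<Longrightarrow> l \<notin> S \<Longrightarrow> z $ l = 0" for z i
  proof -
    have "(A *\<^sub>v z) $ i = (\<Sum>l\<in>{0..<n}. A $$ (i, l) * z $ l)"
      using that A by (auto simp: scalar_prod_def)
    also have "\<dots> = (\<Sum>l\<in>S. A $$ (i, l) * z $ l)"
      using that(3) by (intro sum.mono_neutral_right) (auto simp: S_def)
    finally show ?thesis .
  qed
  have "A *\<^sub>v y = A *\<^sub>v x"
  proof
    fix i assume "i < dim_vec (A *\<^sub>v x)"
    then have i: "i < m" using A by simp
    have "(A *\<^sub>v y) $ i = (\<Sum>l\<in>S. A $$ (i, l) * y $ l)"
      by (rule restrict[OF i y]) (simp add: y_def)
    also have "\<dots> = (\<Sum>l\<in>S. A $$ (i, l) * x $ l - x $ j * (A $$ (i, l) * c l))"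
      by (intro sum.cong) (auto simp: y_def S_def algebra_simps)
    also have "\<dots> = (\<Sum>l\<in>S. A $$ (i, l) * x $ l)"
      using c i by (simp add: sum_subtractf relation_on_def flip: sum_distrib_left)
    also have "\<dots> = (A *\<^sub>v x) $ i"
      by (rule restrict[symmetric, OF i x(1)]) (auto simp: S_def)
    finally show "(A *\<^sub>v y) $ i = (A *\<^sub>v x) $ i" .
  qed simp
  then have "supp_size x \<le> supp_size y" using minimal y x(2) by simp
  moreover have "supp_size y < supp_size x"
  proof -
    have "{l. l < n \<and> y $ l \<noteq> 0} \<subseteq> S - {j}"
      using j by (auto simp: y_def c1 split: if_splits)
    then have "{l. l < n \<and> y $ l \<noteq> 0} \<subset> S" using j by blast
    from psubset_card_mono[OF fin this] show ?thesis
      using x(1) y by (simp add: supp_size_def S_def)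
  qed
  ultimately show False by simp
qed

lemma abs_entry_le_max_norm:
  assumes "A \<in> carrier_mat m n" "i < m" "j < n"
  shows "\<bar>A $$ (i, j)\<bar> \<le> max_norm A"
proof -
  have "A $$ (i, j) \<in> elements_mat A" using assms by auto
  moreover have "elements_mat A = (\<lambda>(i, j). A $$ (i, j)) ` ({..<dim_row A} \<times> {..<dim_col A})"
    by (force simp: elements_mat_def)
  then have "finite (elements_mat A)" by simp
  ultimately show ?thesis unfolding max_norm_def by (intro Max_ge) auto
qed

text \<open>This reduces the problem to numbers: the count of columns \<open>n\<close> has
  disappeared, and \<open>Q\<close> can still be chosen freely.\<close>

lemma min_supp_value_bound:
  assumes "s \<in> min_supp_values m t"
  obtains k where "s \<le> m * Q + k" "(Q + 1) ^ k \<le> (2 * t * k * (Q + 1) + 1) ^ m"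
proof -
  obtain n A b where A: "A \<in> carrier_mat m n" "max_norm A \<le> int t" "b \<in> int_lattice A"
    and s: "s = min_supp A b"
    using assms by (auto simp: min_supp_values_def)
  let ?X = "{supp_size x | x. x \<in> carrier_vec (dim_col A) \<and> A *\<^sub>v x = b}"
  have "Min ?X \<in> ?X"
    using A(3) finite_supp_sizes supp_sizes_nonempty_iff by (intro Min_in) auto
  then obtain x where x: "x \<in> carrier_vec n" "A *\<^sub>v x = b" "s = supp_size x"
    using A(1) by (auto simp: s min_supp_def)
  have minimal: "supp_size x \<le> supp_size y" if "y \<in> carrier_vec n" "A *\<^sub>v y = b" for y
    unfolding x(3)[symmetric] s min_supp_def
    using that A(1) by (intro Min_le finite_supp_sizes) auto
  define S where "S = {j. j < n \<and> x $ j \<noteq> 0}"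
  define R where "R = relation_on m (\<lambda>i j. A $$ (i, j)) S"
  have "\<exists>d::nat. d \<noteq> 1 \<and> (\<forall>c. R c \<longrightarrow> int d dvd c j)" if j: "j \<in> S" for j
  proof -
    obtain d where d: "int d \<in> {c j | c. R c}" "\<And>z. z \<in> {c j | c. R c} \<Longrightarrow> int d dvd z"
    proof (rule int_ideal_generator[of "{c j | c. R c}"])
      have "R (\<lambda>_. 0)" by (simp add: R_def relation_on_def)
      then show "0 \<in> {c j | c. R c}" by force
      show "u - v \<in> {c j | c. R c}" if "u \<in> {c j | c. R c}" "v \<in> {c j | c. R c}" for u v
        using that relation_on_diff unfolding R_def by force
      show "k * u \<in> {c j | c. R c}" if "u \<in> {c j | c. R c}" for k u
        using that relation_on_scale_iff unfolding R_def by force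
    qed blast
    \<comment> \<open>The generator is itself the value of some relation at \<open>j\<close>, so
      \<open>d = 1\<close> would contradict minimality.\<close>
    have "d \<noteq> 1"
      using minimal_support_relations[OF A(1) x(1,2) minimal] d(1) j
      by (auto simp: R_def S_def)
    with d(2) show ?thesis by blast
  qed
  then obtain d :: "nat \<Rightarrow> nat" where
    d: "\<And>j. j \<in> S \<Longrightarrow> d j \<noteq> 1" "\<And>j c. j \<in> S \<Longrightarrow> R c \<Longrightarrow> int (d j) dvd c j"
    by metis
  have "card S = s" using x(1) by (simp add: x(3) supp_size_def S_def)
  moreover have "finite S" by (simp add: S_def)
  moreover have "\<bar>A $$ (i, j)\<bar> \<le> int t" if "i < m" "j \<in> S" for i j
    using abs_entry_le_max_norm[OF A(1), of i j] that A(2) by (auto simp: S_def)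
  ultimately show thesis
    using card_split_bound[of S m "\<lambda>i j. A $$ (i, j)" t d Q] d that by (metis R_def)
qed

section \<open>Logarithmic estimates and the choice of \<open>Q\<close>\<close>

text \<open>Taking logarithms in \<open>le\<close> bounds \<open>k * ln (Q + 1)\<close> by
  \<open>m\<close> times a logarithm in which \<open>k\<close> occurs again. As
  \<open>ln (Q + 1)\<close> is at least \<open>ln l / 2\<close>, that occurrence can be absorbed on
  the left.\<close>

lemma large_part_bound:
  fixes m t k Q :: nat
  defines "l \<equiv> ln (sqrt (real m) * real t)"
  assumes m: "m > 0" and t: "t > 0" and l: "ln l \<ge> 4" "l > 0"
    and Q: "sqrt l \<le> real (Q + 1)" "real (Q + 1) \<le> 2 * sqrt l"
    and le: "(Q + 1) ^ k \<le> (2 * t * k * (Q + 1) + 1) ^ m"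
  shows "real k \<le> 20 * (real m * l / ln l)"
proof -
  have lnl: "ln l \<le> l" using ln_bound[of l] l by simp
  \<comment> \<open>After scaling by \<open>m\<close>, the factor \<open>m\<close> inside the
    logarithm joins \<open>t\<close>, and \<open>ln (m * t)\<close> is comparable to
    \<open>l\<close>.\<close>
  define u where "u = real k / real m"
  have k: "real k = real m * u" using m by (simp add: u_def)
  have "u \<le> 20 * (l / ln l)"
  proof (cases "u \<le> 1")
    case True
    have "1 \<le> 20 * (l / ln l)" using lnl l by (simp add: field_simps)
    with True show ?thesis by linarith
  next
    case False
    define B where "B = real (Q + 1)"
    have B1: "B \<ge> 1" by (simp add: B_def)
    have "real k * ln B = ln (B ^ k)" using B1 by (simp add: ln_realpow)
    also have "\<dots> \<le> ln ((2 * real t * real k * B + 1) ^ m)"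
    proof -
      have "real ((Q + 1) ^ k) \<le> real ((2 * t * k * (Q + 1) + 1) ^ m)"
        using le by (simp only: of_nat_le_iff)
      then have "B ^ k \<le> (2 * real t * real k * B + 1) ^ m" by (simp add: B_def algebra_simps)
      then show ?thesis using B1 by (intro ln_mono) auto
    qed
    also have "\<dots> = real m * ln (2 * real t * real k * B + 1)"
      using B1 by (simp add: ln_realpow add_nonneg_pos)
    finally have "u * ln B \<le> ln (2 * real t * real k * B + 1)"
      using m by (simp add: k)
    \<comment> \<open>The summand 1 is at most \<open>t * k * B\<close>, which gives a factor 3;
      \<open>B \<le> 2 * sqrt l\<close> doubles it.\<close>
    also have "\<dots> \<le> ln (6 * (real m * real t) * u * sqrt l)"
    proof (rule ln_mono)
      have "1 \<le> real k"
        using False m by (simp add: u_def field_simps)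
      then have "1 * 1 * 1 \<le> real t * real k * B" using t B1 by (intro mult_mono) auto
      then have "2 * real t * real k * B + 1 \<le> 3 * (real t * real k) * B"
        by (simp add: mult.commute)
      also have "\<dots> \<le> 3 * (real t * real k) * (2 * sqrt l)"
        using Q(2) by (intro mult_left_mono) (auto simp: B_def)
      finally show "2 * real t * real k * B + 1 \<le> 6 * (real m * real t) * u * sqrt l"
        by (simp add: k mult_ac)
    qed (use B1 in \<open>auto intro!: add_nonneg_pos\<close>)
    also have "\<dots> = ln 6 + ln (real m * real t) + ln u + ln l / 2"
      using m t False l by (simp add: ln_mult ln_sqrt)
    also have "ln (real m * real t) \<le> 2 * l"
    proof -
      have "real m * real t \<le> (sqrt (real m) * real t) ^ 2"
        using t self_le_power[of "real t" 2] by (simp add: power_mult_distrib mult_left_mono)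
      then have "ln (real m * real t) \<le> ln ((sqrt (real m) * real t) ^ 2)"
        using m t by (intro ln_mono) auto
      also have "\<dots> = 2 * l" using m t by (simp add: l_def ln_realpow)
      finally show ?thesis .
    qed
    also have "ln 6 \<le> (5::real)" using ln_le_minus_one[of "6::real"] by simp
    \<comment> \<open>This crude bound suffices: \<open>u\<close> is at most a quarter of
      \<open>u * ln l\<close>, while the left side will be at least half of it.\<close>
    also have "ln u \<le> u" using ln_bound[of u] False by simp
    finally have 1: "u * ln B \<le> 5 + 2 * l + u + ln l / 2" by simp
    have "ln l / 2 = ln (sqrt l)" using l by (simp add: ln_sqrt)
    also have "\<dots> \<le> ln B" using Q(1) l by (intro ln_mono) (auto simp: B_def)
    finally have "u * (ln l / 2) \<le> u * ln B" using False by (intro mult_left_mono) auto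
    moreover have "u * 4 \<le> u * ln l" using False l by (intro mult_left_mono) auto
    \<comment> \<open>What remains is \<open>u * ln l / 4 \<le> 5 + 2 * l + ln l / 2\<close>, where
      \<open>4 \<le> ln l \<le> l\<close> bounds the right side by a multiple of
      \<open>l\<close>.\<close>
    ultimately have "u * ln l \<le> 20 * l" using 1 lnl l by linarith
    then show ?thesis using l pos_le_divide_eq[of "ln l" u "20 * l"] by linarith
  qed
  then have "real m * u \<le> real m * (20 * (l / ln l))" by (intro mult_left_mono) auto
  then show ?thesis by (simp add: k mult.left_commute)
qed

text \<open>With \<open>Q\<close> near \<open>sqrt l\<close>, the small divisors cost only about
  \<open>m * sqrt l\<close>, while \<open>ln (Q + 1)\<close> keeps the order of \<open>ln l\<close>.
  The two parts contribute 2 and 20 to the constant.\<close>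

lemma min_supp_value_log_bound:
  fixes m t s :: nat
  defines "l \<equiv> ln (sqrt (real m) * real t)"
  assumes s: "s \<in> min_supp_values m t" and m: "m > 0" and t: "t > 0"
    and l: "ln l \<ge> 4" "l > 0"
  shows "real s \<le> 22 * (real m * l / ln l)"
proof -
  define Q where "Q = nat \<lfloor>sqrt l\<rfloor>"
  have l1: "l \<ge> 1" using l ln_bound[of l] by simp
  have Q: "real Q \<le> sqrt l" "sqrt l \<le> real (Q + 1)" "real (Q + 1) \<le> 2 * sqrt l"
    using real_sqrt_ge_one[OF l1] unfolding Q_def by linarith+
  obtain k where k: "s \<le> m * Q + k" "(Q + 1) ^ k \<le> (2 * t * k * (Q + 1) + 1) ^ m"
    using min_supp_value_bound[OF s, of Q] by metis
  \<comment> \<open>Applying \<open>ln y \<le> y\<close> to \<open>sqrt l\<close> shows that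
    \<open>sqrt l\<close> is at most \<open>2 * (l / ln l)\<close>.\<close>
  have "ln l \<le> 2 * sqrt l"
    using ln_bound[of "sqrt l"] l by (simp add: ln_sqrt)
  then have "sqrt l * ln l \<le> sqrt l * (2 * sqrt l)" using l by (intro mult_left_mono) auto
  also have "\<dots> = 2 * l" using l by simp
  finally have "sqrt l \<le> 2 * (l / ln l)"
    using l pos_le_divide_eq[of "ln l" "sqrt l" "2 * l"] by linarith
  then have "real m * real Q \<le> real m * (2 * (l / ln l))"
    using Q(1) by (intro mult_left_mono) auto
  also have "\<dots> = 2 * (real m * l / ln l)" by simp
  finally have "real m * real Q \<le> 2 * (real m * l / ln l)" .
  moreover have "real k \<le> 20 * (real m * l / ln l)"
    using large_part_bound[OF m t, of Q k] l Q(2,3) k(2) by (simp add: l_def)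
  moreover have "real s \<le> real m * real Q + real k"
    using k(1) by (metis of_nat_add of_nat_le_iff of_nat_mult)
  ultimately show ?thesis by linarith
qed

theorem theorem2:
  shows "\<exists>K>0::real. \<exists>N>0::real. \<forall>m t :: nat. m > 0 \<longrightarrow> t > 0 \<longrightarrow> sqrt (real m) * real t \<ge> N \<longrightarrow>
    ereal_of_enat (h m t) \<le>
      ereal (K * (real m * ln (sqrt (real m) * real t) / ln (ln (sqrt (real m) * real t))))"
proof (rule exI[of _ 22], rule conjI, simp, rule exI[of _ "exp (exp 4)"], intro conjI allI impI)
  fix m t :: nat
  assume m: "m > 0" and t: "t > 0" and N: "exp (exp 4) \<le> sqrt (real m) * real t"
  define l where "l = ln (sqrt (real m) * real t)"
  define R where "R = 22 * (real m * l / ln l)"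
  \<comment> \<open>The threshold \<open>exp (exp 4)\<close> is chosen to give
    \<open>ln l \<ge> 4\<close>.\<close>
  have "exp 4 \<le> l" unfolding l_def using N m t by (subst ln_ge_iff) auto
  moreover from this have l0: "l > 0" by (meson exp_gt_zero less_le_trans)
  ultimately have l: "ln l \<ge> 4" by (simp add: ln_ge_iff)
  have R0: "R \<ge> 0" using l l0 unfolding R_def
    by (intro mult_nonneg_nonneg divide_nonneg_pos) linarith+
  \<comment> \<open>The supremum is taken in \<open>enat\<close>, so the real bound is first rounded
    down to a natural number; this also shows that \<open>h m t\<close> is finite.\<close>
  have "h m t \<le> enat (nat \<lfloor>R\<rfloor>)"
    unfolding h_def
  proof (rule SUP_least)
    fix s assume "s \<in> min_supp_values m t"
    from min_supp_value_log_bound[OF this m t] l l0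
    have "real s \<le> R" by (simp add: l_def R_def)
    then show "enat s \<le> enat (nat \<lfloor>R\<rfloor>)" by (simp add: le_nat_floor)
  qed
  then have "ereal_of_enat (h m t) \<le> ereal_of_enat (enat (nat \<lfloor>R\<rfloor>))"
    by (simp only: ereal_of_enat_le_iff)
  also have "\<dots> \<le> ereal R" using R0 by simp
  finally show "ereal_of_enat (h m t) \<le> ereal (22 * (real m * ln (sqrt (real m) * real t) /
      ln (ln (sqrt (real m) * real t))))"
    by (simp add: R_def l_def)
qed simp

end
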